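(* For the class of network contribution games with reward functions $f_e\in\mathcal{C}$ for all $e\in E$ that have a pairwise equilibrium, the price of anarchy and the price of stability for pairwise equilibria are both exactly $2$.
   Context: Network contribution game: a finite simple undirected graph $G=(V,E)$; every node $v\in V$ is a player with budget $B_v\ge 0$. Let $E_v$ be the set of edges incident to $v$. A strategy of $v$ is a function $s_v:E_v\to\mathbb{R}_{\ge 0}$ with $\sum_{e\in E_v}s_v(e)\le B_v$; a state $s=(s_v)_{v\in V}$ consists of one strategy per player. Each edge $e=(u,v)$ has a reward function $f_e:\mathbb{R}_{\ge 0}^2\to\mathbb{R}_{\ge 0}$ that is nondecreasing in each argument, symmetric, continuous and differentiable. The utility of $v$ is $w_v(s)=\sum_{e=(v,u)\in E_v}f_e(s_v(e),s_u(e))$, and the social welfare is $w(s)=\sum_{v\in V}w_v(s)$. A social optimum $s^*$ is a state maximizing $w$. A state $s$ is a (pure) Nash equilibrium if $w_v(s)\ge w_v(s_v',s_{-v})$ for every player $v$ and every strategy $s_v'$. An improving bilateral deviation in $s$ is a pair of strategies $(s_u',s_v')$ of two players $u\neq v$ with $w_u(s_u',s_v',s_{-u,v})>w_u(s)$ and $w_v(s_u',s_v',s_{-u,v})>w_v(s)$. A pairwise equilibrium is a Nash equilibrium that admits no improving bilateral deviation. For a game with pairwise equilibria, the price of anarchy (stability) for pairwise equilibria is the ratio $w(s^* )/w(s)$ for the worst (best) pairwise equilibrium $s$, i.e. the one with smallest (largest) welfare. For a class of games it is the worst (supremum) value over all games in the class that have pairwise equilibria. A function $f$ is coordinate-convex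 if $\partial^2 f/\partial x_i^2\ge 0$ for each of its arguments $x_i$. The class $\mathcal{C}$ consists of all symmetric nondecreasing coordinate-convex functions $f:\mathbb{R}_{\ge0}\times\mathbb{R}_{\ge0}\to\mathbb{R}_{\ge0}$. *)

theory Defs
  imports "HOL-Analysis.Analysis"
begin

text \<open>
  Reward functions are curried functions on \<open>real\<close>. Only their values on the closed
  quadrant \<open>{0..} \<times> {0..}\<close> are ever constrained or used, and derivatives are taken
  within that domain (hence one-sided on its boundary).
\<close>

definition nonneg_valued :: "(real \<Rightarrow> real \<Rightarrow> real) \<Rightarrow> bool" where
  "nonneg_valued f \<longleftrightarrow> (\<forall>x\<ge>0. \<forall>y\<ge>0. f x y \<ge> 0)"

definition symmetric_fun :: "(real \<Rightarrow> real \<Rightarrow> real) \<Rightarrow> bool" where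
  "symmetric_fun f \<longleftrightarrow> (\<forall>x\<ge>0. \<forall>y\<ge>0. f x y = f y x)"

definition nondecreasing_fun :: "(real \<Rightarrow> real \<Rightarrow> real) \<Rightarrow> bool" where
  "nondecreasing_fun f \<longleftrightarrow>
     (\<forall>y\<ge>0. mono_on {0..} (\<lambda>x. f x y)) \<and> (\<forall>x\<ge>0. mono_on {0..} (\<lambda>y. f x y))"

definition reward_function :: "(real \<Rightarrow> real \<Rightarrow> real) \<Rightarrow> bool" where
  "reward_function f \<longleftrightarrow>
     nonneg_valued f \<and> nondecreasing_fun f \<and> symmetric_fun f \<and>
     continuous_on ({0..} \<times> {0..}) (\<lambda>(x, y). f x y) \<and>
     (\<lambda>(x, y). f x y) differentiable_on ({0..} \<times> {0..})"

definition second_derivative_nonneg :: "(real \<Rightarrow> real) \<Rightarrow> bool" where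
  "second_derivative_nonneg g \<longleftrightarrow>
     (\<exists>g' g''. \<forall>x\<ge>0.
        (g has_real_derivative g' x) (at x within {0..}) \<and>
        (g' has_real_derivative g'' x) (at x within {0..}) \<and>
        g'' x \<ge> 0)"

definition coordinate_convex :: "(real \<Rightarrow> real \<Rightarrow> real) \<Rightarrow> bool" where
  "coordinate_convex f \<longleftrightarrow>
     (\<forall>y\<ge>0. second_derivative_nonneg (\<lambda>x. f x y)) \<and>
     (\<forall>x\<ge>0. second_derivative_nonneg (\<lambda>y. f x y))"

definition class_C :: "(real \<Rightarrow> real \<Rightarrow> real) set" where
  "class_C = {f. nonneg_valued f \<and> symmetric_fun f \<and> nondecreasing_fun f \<and> coordinate_convex f}"

text \<open>An undirected edge is the two-element set of its endpoints.\<close>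

record 'v game =
  verts :: "'v set"
  edges :: "'v set set"
  budget :: "'v \<Rightarrow> real"
  reward :: "'v set \<Rightarrow> real \<Rightarrow> real \<Rightarrow> real"

definition contribution_game :: "'v game \<Rightarrow> bool" where
  "contribution_game G \<longleftrightarrow>
     finite (verts G) \<and>
     edges G \<subseteq> {{u, v} | u v. u \<in> verts G \<and> v \<in> verts G \<and> u \<noteq> v} \<and>
     (\<forall>v\<in>verts G. budget G v \<ge> 0) \<and>
     (\<forall>e\<in>edges G. reward_function (reward G e))"

definition incident :: "'v game \<Rightarrow> 'v \<Rightarrow> 'v set set" where
  "incident G v = {e \<in> edges G. v \<in> e}"

definition strategies :: "'v game \<Rightarrow> 'v \<Rightarrow> ('v set \<Rightarrow> real) set" where
  "strategies G v =
     {t \<in> incident G v \<rightarrow>\<^sub>E {0..}. (\<Sum>e\<in>incident G v. t e) \<le> budget G v}"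

definition states :: "'v game \<Rightarrow> ('v \<Rightarrow> 'v set \<Rightarrow> real) set" where
  "states G = (\<Pi>\<^sub>E v\<in>verts G. strategies G v)"

text \<open>
  The graph is simple, so summing over the edges \<open>{v, u}\<close> at \<open>v\<close> is the same as summing
  over the neighbours \<open>u\<close> of \<open>v\<close>.
\<close>

definition utility :: "'v game \<Rightarrow> ('v \<Rightarrow> 'v set \<Rightarrow> real) \<Rightarrow> 'v \<Rightarrow> real" where
  "utility G s v =
     (\<Sum>u | {v, u} \<in> edges G. reward G {v, u} (s v {v, u}) (s u {v, u}))"

definition welfare :: "'v game \<Rightarrow> ('v \<Rightarrow> 'v set \<Rightarrow> real) \<Rightarrow> real" where
  "welfare G s = (\<Sum>v\<in>verts G. utility G s v)"

definition social_optimum :: "'v game \<Rightarrow> ('v \<Rightarrow> 'v set \<Rightarrow> real) \<Rightarrow> bool" where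
  "social_optimum G s \<longleftrightarrow> s \<in> states G \<and> (\<forall>s'\<in>states G. welfare G s' \<le> welfare G s)"

definition nash_equilibrium :: "'v game \<Rightarrow> ('v \<Rightarrow> 'v set \<Rightarrow> real) \<Rightarrow> bool" where
  "nash_equilibrium G s \<longleftrightarrow>
     s \<in> states G \<and>
     (\<forall>v\<in>verts G. \<forall>t\<in>strategies G v. utility G s v \<ge> utility G (s(v := t)) v)"

definition improving_bilateral_deviation ::
    "'v game \<Rightarrow> ('v \<Rightarrow> 'v set \<Rightarrow> real) \<Rightarrow> 'v \<Rightarrow> 'v \<Rightarrow>
     ('v set \<Rightarrow> real) \<Rightarrow> ('v set \<Rightarrow> real) \<Rightarrow> bool" where
  "improving_bilateral_deviation G s u v t t' \<longleftrightarrow>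
     u \<in> verts G \<and> v \<in> verts G \<and> u \<noteq> v \<and>
     t \<in> strategies G u \<and> t' \<in> strategies G v \<and>
     utility G (s(u := t, v := t')) u > utility G s u \<and>
     utility G (s(u := t, v := t')) v > utility G s v"

definition pairwise_equilibrium :: "'v game \<Rightarrow> ('v \<Rightarrow> 'v set \<Rightarrow> real) \<Rightarrow> bool" where
  "pairwise_equilibrium G s \<longleftrightarrow>
     nash_equilibrium G s \<and> (\<nexists>u v t t'. improving_bilateral_deviation G s u v t t')"

text \<open>
  The ratio \<open>a / b\<close> of nonnegative welfares is \<open>\<top>\<close> if \<open>b = 0 < a\<close>. If both
  welfares vanish the equilibrium is itself optimal, and the ratio is taken to be 1
  (\<open>ennreal\<close> division alone would give 0).
\<close>

definition welfare_ratio :: "real \<Rightarrow> real \<Rightarrow> ennreal" where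
  "welfare_ratio a b = (if a = 0 \<and> b = 0 then 1 else ennreal a / ennreal b)"

text \<open>
  The worst (smallest welfare) equilibrium has the largest ratio, the best (largest
  welfare) equilibrium the smallest; all social optima have the same welfare. The two
  prices of a game are meaningful only if it has a pairwise equilibrium.
\<close>

definition price_of_anarchy :: "'v game \<Rightarrow> ennreal" where
  "price_of_anarchy G =
     Sup {welfare_ratio (welfare G s') (welfare G s) | s' s.
            social_optimum G s' \<and> pairwise_equilibrium G s}"

definition price_of_stability :: "'v game \<Rightarrow> ennreal" where
  "price_of_stability G =
     Inf {welfare_ratio (welfare G s') (welfare G s) | s' s.
            social_optimum G s' \<and> pairwise_equilibrium G s}"

definition class_price_of_anarchy :: "'v game set \<Rightarrow> ennreal" where
  "class_price_of_anarchy \<G> =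
     (SUP G\<in>{G \<in> \<G>. \<exists>s. pairwise_equilibrium G s}. price_of_anarchy G)"

definition class_price_of_stability :: "'v game set \<Rightarrow> ennreal" where
  "class_price_of_stability \<G> =
     (SUP G\<in>{G \<in> \<G>. \<exists>s. pairwise_equilibrium G s}. price_of_stability G)"

definition convex_games :: "'v game set" where
  "convex_games = {G. contribution_game G \<and> (\<forall>e\<in>edges G. reward G e \<in> class_C)}"

end

theory Submission imports Defs begin

text \<open>
  Upper bound. Welfare is convex in each single player's strategy, so some optimum lets every
  player invest the whole budget in at most one edge. Subtract the base rewards \<open>f\<^sub>e(0,0)\<close>. An edge
  used in that optimum by one endpoint is worth at most that endpoint's equilibrium utility (unilateral
  deviation); an edge used by both is worth at most the equilibrium utility of one of them (bilateral
  deviation). Every player is charged for at most one edge, and an edge pays two players, hence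
  the factor 2.

  Lower bound. On a path \<open>a - b - c - d\<close> with unit budgets and rewards \<open>w\<^sub>e x y\<close>, where the middle edge has
  weight \<open>1 + \<epsilon>\<close> and the outer edges weight 1, the players \<open>b\<close> and \<open>c\<close> invest everything in the middle
  edge in every pairwise equilibrium, for a welfare of \<open>2(1 + \<epsilon>)\<close>; the outer edges give 4.
\<close>

section \<open>Convexity of one-variable rewards\<close>

text \<open>By the mean value theorem, the secant slopes left and right of an interior
  \<open>x\<close> are values of \<open>g'\<close> at points \<open>z1 < x < z2\<close>, and
  \<open>g'' \<ge> 0\<close> orders these values. At the endpoints the claim is an equality;
  \<open>B = 0\<close> forces \<open>x = 0\<close>.\<close>

lemma second_derivative_nonneg_chord:
  assumes g: "second_derivative_nonneg g" and x: "0 \<le> x" "x \<le> B"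
  shows "g x \<le> g 0 + x / B * (g B - g 0)"
proof -
  obtain g' g'' where
    d1: "\<And>x. x \<ge> 0 \<Longrightarrow> (g has_real_derivative g' x) (at x within {0..})" and
    d2: "\<And>x. x \<ge> 0 \<Longrightarrow> (g' has_real_derivative g'' x) (at x within {0..})" and
    pos: "\<And>x. x \<ge> 0 \<Longrightarrow> g'' x \<ge> 0"
    using g unfolding second_derivative_nonneg_def by metis
  \<comment> \<open>Derivatives within \<open>{0..}\<close> are one-sided at 0; restricting them to
    \<open>{p..q}\<close> allows \<open>p = 0\<close>. The fact is used for \<open>g\<close> twice
    and then for \<open>g'\<close>.\<close>
  have mean_value: "\<exists>z\<in>{p<..<q}. h q - h p = h' z * (q - p)"
    if "\<And>x. x \<ge> 0 \<Longrightarrow> (h has_real_derivative h' x) (at x within {0..})" "0 \<le> p" "p < q"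
    for h h' :: "real \<Rightarrow> real" and p q
  proof (rule mvt_simple[OF \<open>p < q\<close>])
    fix x assume "p \<le> x" "x \<le> q"
    then have "(h has_real_derivative h' x) (at x within {p..q})"
      using that by (intro DERIV_subset[OF that(1)]) auto
    then show "(h has_derivative (*) (h' x)) (at x within {p..q})"
      by (simp add: has_field_derivative_def)
  qed
  consider "x = 0" | "x = B" "x > 0" | "0 < x" "x < B" using x by linarith
  then show ?thesis
  proof cases
    case 3
    obtain z1 where z1: "0 < z1" "z1 < x" "g x - g 0 = g' z1 * (x - 0)"
      using mean_value[OF d1, of 0 x] 3 by auto
    obtain z2 where z2: "x < z2" "z2 < B" "g B - g x = g' z2 * (B - x)"
      using mean_value[OF d1, of x B] 3 by auto
    obtain z where z: "z1 < z" "z < z2" "g' z2 - g' z1 = g'' z * (z2 - z1)"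
      using mean_value[OF d2, of z1 z2] z1 z2 by auto
    have "g' z1 \<le> g' z2" using z pos[of z] z1 by (smt (verit) mult_nonneg_nonneg)
    \<comment> \<open>The factor clears the denominators \<open>x\<close> and \<open>B - x\<close>
      of the two secant slopes.\<close>
    then have "(x * (B - x)) * g' z1 \<le> (x * (B - x)) * g' z2"
      using 3 by (intro mult_left_mono) auto
    then have "(B - x) * (g x - g 0) \<le> x * (g B - g x)"
      unfolding z1 z2 by (simp add: algebra_simps)
    then have "B * g x \<le> B * g 0 + x * (g B - g 0)" by (simp add: algebra_simps)
    then show ?thesis using 3 by (simp add: field_simps)
  qed auto
qed

lemma finite_attains_max:
  fixes f :: "'a \<Rightarrow> real"
  assumes "finite S" "S \<noteq> {}"
  obtains x where "x \<in> S" "\<And>y. y \<in> S \<Longrightarrow> f y \<le> f x"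
proof -
  have "Max (f ` S) \<in> f ` S" using assms by simp
  then obtain x where "x \<in> S" "Max (f ` S) = f x" by auto
  then show ?thesis using that[of x] assms(1) by (metis Max_ge finite_imageI imageI)
qed

section \<open>Convex games and sums over neighbours\<close>

definition nbrs :: "'v game \<Rightarrow> 'v \<Rightarrow> 'v set" where
  "nbrs G v = {u. {v, u} \<in> edges G}"

definition single_edge_strategy :: "'v game \<Rightarrow> 'v \<Rightarrow> 'v set \<Rightarrow> 'v set \<Rightarrow> real" where
  "single_edge_strategy G v e0 = (\<lambda>e\<in>incident G v. if e = e0 then budget G v else 0)"

text \<open>Elements of \<open>Pow (verts G)\<close> that are not edges at \<open>v\<close> stand for the zero strategy.\<close>

definition single_edge_states :: "'v game \<Rightarrow> ('v \<Rightarrow> 'v set \<Rightarrow> real) set" where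
  "single_edge_states G = (\<Pi>\<^sub>E v\<in>verts G. single_edge_strategy G v ` Pow (verts G))"

locale convex_game =
  fixes G :: "'v game"
  assumes convex_games: "G \<in> convex_games"
begin

lemma game: "contribution_game G"
  using convex_games by (simp add: convex_games_def)

lemma finite_verts [simp]: "finite (verts G)"
  using game by (simp add: contribution_game_def)

lemma budget_nonneg: "v \<in> verts G \<Longrightarrow> 0 \<le> budget G v"
  using game by (simp add: contribution_game_def)

lemma edge_subset_verts: "e \<in> edges G \<Longrightarrow> e \<subseteq> verts G"
  using game unfolding contribution_game_def by blast

lemma nbrsD:
  assumes "u \<in> nbrs G v"
  shows "u \<in> verts G" "v \<in> verts G" "u \<noteq> v" "v \<in> nbrs G u" "{v, u} \<in> edges G"
proof -
  have e: "{v, u} \<in> edges G" using assms by (simp add: nbrs_def)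
  then obtain a b where "{v, u} = {a, b}" "a \<in> verts G" "b \<in> verts G" "a \<noteq> b"
    using game unfolding contribution_game_def by blast
  then show "u \<in> verts G" "v \<in> verts G" "u \<noteq> v" by (auto simp: doubleton_eq_iff)
  show "v \<in> nbrs G u" "{v, u} \<in> edges G" using e by (auto simp: nbrs_def insert_commute)
qed

lemma finite_nbrs [simp]: "finite (nbrs G v)"
  by (rule finite_subset[OF _ finite_verts]) (use nbrsD(1) in auto)

lemma incident_eq: "incident G v = (\<lambda>u. {v, u}) ` nbrs G v"
proof
  show "incident G v \<subseteq> (\<lambda>u. {v, u}) ` nbrs G v"
  proof
    fix e assume e: "e \<in> incident G v"
    then obtain a b where "e = {a, b}"
      using game unfolding contribution_game_def incident_def by blast
    then show "e \<in> (\<lambda>u. {v, u}) ` nbrs G v"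
      using e by (auto simp: incident_def nbrs_def insert_commute)
  qed
qed (auto simp: incident_def nbrs_def)

lemma finite_incident [simp]: "finite (incident G v)"
  by (simp add: incident_eq)

lemma sum_incident: "(\<Sum>e\<in>incident G v. h e) = (\<Sum>u\<in>nbrs G v. h {v, u})"
  unfolding incident_eq
  by (rule sum.reindex_cong[OF _ refl refl]) (auto simp: inj_on_def doubleton_eq_iff)

text \<open>Adjacency is symmetric, so exchanging the two sums visits the same ordered pairs. In the
  charging argument this converts charges to the far endpoint into charges to the near one.\<close>

lemma sum_nbrs_swap:
  "(\<Sum>v\<in>verts G. \<Sum>u\<in>nbrs G v. h u v) = (\<Sum>v\<in>verts G. \<Sum>u\<in>nbrs G v. h v u)"
proof -
  have eq: "nbrs G v = {u \<in> verts G. {v, u} \<in> edges G}" for v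
    using nbrsD(1) by (auto simp: nbrs_def)
  show ?thesis
    unfolding eq by (subst sum.swap_restrict) (auto simp: insert_commute)
qed

lemma utility_eq:
  "utility G s v = (\<Sum>u\<in>nbrs G v. reward G {v, u} (s v {v, u}) (s u {v, u}))"
  by (simp add: utility_def nbrs_def)

lemma reward_nonneg: "\<lbrakk>e \<in> edges G; 0 \<le> x; 0 \<le> y\<rbrakk> \<Longrightarrow> 0 \<le> reward G e x y"
  using game by (auto simp: contribution_game_def reward_function_def nonneg_valued_def)

lemma reward_commute: "\<lbrakk>e \<in> edges G; 0 \<le> x; 0 \<le> y\<rbrakk> \<Longrightarrow> reward G e x y = reward G e y x"
  using game by (auto simp: contribution_game_def reward_function_def symmetric_fun_def)

lemma reward_mono:
  assumes "e \<in> edges G" "0 \<le> x" "x \<le> x'" "0 \<le> y" "y \<le> y'"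
  shows "reward G e x y \<le> reward G e x' y'"
proof -
  have nd: "nondecreasing_fun (reward G e)"
    using game assms(1) by (auto simp: contribution_game_def reward_function_def)
  have "reward G e x y \<le> reward G e x' y"
    using nd assms unfolding nondecreasing_fun_def mono_on_def by auto
  also have "\<dots> \<le> reward G e x' y'"
    using nd assms unfolding nondecreasing_fun_def mono_on_def by auto
  finally show ?thesis .
qed

lemma reward_chord:
  assumes "e \<in> edges G" "0 \<le> x" "x \<le> B" "0 \<le> y"
  shows "reward G e x y \<le> reward G e 0 y + x / B * (reward G e B y - reward G e 0 y)"
proof -
  have "second_derivative_nonneg (\<lambda>x. reward G e x y)"
    using convex_games assms
    by (auto simp: convex_games_def class_C_def coordinate_convex_def)
  from second_derivative_nonneg_chord[OF this assms(2,3)] show ?thesis .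
qed

lemma strategy_nonneg: "\<lbrakk>t \<in> strategies G v; u \<in> nbrs G v\<rbrakk> \<Longrightarrow> 0 \<le> t {v, u}"
  by (auto simp: strategies_def incident_eq)

lemma strategy_sum_le: "t \<in> strategies G v \<Longrightarrow> (\<Sum>u\<in>nbrs G v. t {v, u}) \<le> budget G v"
  by (auto simp: strategies_def sum_incident)

lemma state_strategy: "\<lbrakk>s \<in> states G; v \<in> verts G\<rbrakk> \<Longrightarrow> s v \<in> strategies G v"
  by (auto simp: states_def)

lemma state_update: "\<lbrakk>s \<in> states G; v \<in> verts G; t \<in> strategies G v\<rbrakk> \<Longrightarrow> s(v := t) \<in> states G"
  by (auto simp: states_def PiE_iff extensional_def)

lemma state_nonneg:
  assumes "s \<in> states G" "u \<in> nbrs G v"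
  shows "0 \<le> s v {v, u}" "0 \<le> s u {v, u}"
  using strategy_nonneg[OF state_strategy, of s v u] strategy_nonneg[OF state_strategy, of s u v]
    assms nbrsD[OF assms(2)] by (auto simp: insert_commute)

lemma contribution_le_budget:
  assumes "s \<in> states G" "u \<in> nbrs G v"
  shows "s v {v, u} \<le> budget G v"
proof -
  have "s v {v, u} \<le> (\<Sum>u\<in>nbrs G v. s v {v, u})"
    using assms state_nonneg(1)[OF assms(1)] by (intro member_le_sum) auto
  also have "\<dots> \<le> budget G v"
    using strategy_sum_le state_strategy assms nbrsD by blast
  finally show ?thesis .
qed

lemma utility_nonneg: "s \<in> states G \<Longrightarrow> 0 \<le> utility G s v"
  unfolding utility_eq by (intro sum_nonneg reward_nonneg state_nonneg nbrsD(5)) auto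

lemma welfare_nonneg: "s \<in> states G \<Longrightarrow> 0 \<le> welfare G s"
  unfolding welfare_def by (intro sum_nonneg utility_nonneg)

section \<open>Optima made of single-edge strategies\<close>

text \<open>Only edges at \<open>v\<close> change, and by symmetry of the rewards each of them
  changes by the same amount for both endpoints. Welfare therefore changes by exactly twice the
  change in the utility of \<open>v\<close>.\<close>

lemma welfare_update_mono:
  assumes s: "s \<in> states G" and v: "v \<in> verts G" and t: "t \<in> strategies G v"
    and le: "utility G s v \<le> utility G (s(v := t)) v"
  shows "welfare G s \<le> welfare G (s(v := t))"
proof -
  let ?s = "s(v := t)"
  have s': "?s \<in> states G" by (rule state_update[OF s v t])
  define D where "D = (\<lambda>v u. reward G {v, u} (?s v {v, u}) (?s u {v, u}) -
    reward G {v, u} (s v {v, u}) (s u {v, u}))"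
  have D_sym: "D w v = D v w" if "w \<in> nbrs G v" for w
    using reward_commute[OF nbrsD(5)[OF that]] state_nonneg[OF s that] state_nonneg[OF s' that]
    by (simp add: D_def insert_commute)
  have diff: "utility G ?s w - utility G s w = (\<Sum>u\<in>nbrs G w. D w u)" for w
    by (simp add: utility_eq D_def sum_subtractf)
  \<comment> \<open>Another player \<open>w\<close> notices the move only on its edge to
    \<open>v\<close>, if there is one.\<close>
  have other: "(\<Sum>u\<in>nbrs G w. D w u) = (if w \<in> nbrs G v then D v w else 0)" if "w \<noteq> v" for w
  proof -
    have "(\<Sum>u\<in>nbrs G w. D w u) = (\<Sum>u\<in>nbrs G w. if u = v then D w v else 0)"
      using that by (intro sum.cong) (auto simp: D_def)
    also have "\<dots> = (if w \<in> nbrs G v then D v w else 0)"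
      using nbrsD(4) D_sym by auto
    finally show ?thesis .
  qed
  have "welfare G ?s - welfare G s = (\<Sum>w\<in>verts G. \<Sum>u\<in>nbrs G w. D w u)"
    by (simp add: welfare_def diff sum_subtractf[symmetric])
  also have "\<dots> = (\<Sum>u\<in>nbrs G v. D v u) + (\<Sum>w\<in>verts G - {v}. \<Sum>u\<in>nbrs G w. D w u)"
    using v by (simp add: sum.remove)
  also have "(\<Sum>w\<in>verts G - {v}. \<Sum>u\<in>nbrs G w. D w u) =
      (\<Sum>w\<in>verts G - {v}. if w \<in> nbrs G v then D v w else 0)"
    by (intro sum.cong refl other) auto
  also have "\<dots> = (\<Sum>w\<in>nbrs G v. D v w)"
    by (rule sum.mono_neutral_cong_right) (use nbrsD(1,3) in auto)
  finally show ?thesis using le diff[of v] by linarith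
qed

lemma single_edge_strategy_in:
  assumes v: "v \<in> verts G"
  shows "single_edge_strategy G v e0 \<in> strategies G v"
proof -
  have "(\<Sum>e\<in>incident G v. if e = e0 then budget G v else 0) \<le> budget G v"
    using budget_nonneg[OF v] by simp
  then show ?thesis
    using budget_nonneg[OF v] by (auto simp: strategies_def single_edge_strategy_def)
qed

text \<open>With the other players fixed, replacing each reward by its chord over
  \<open>[0, B]\<close> gives an upper bound that is affine in the contributions of
  \<open>v\<close>. It is largest when the whole budget goes to the neighbour with the steepest
  chord, and there the chord agrees with the reward.\<close>

lemma single_edge_response:
  assumes s: "s \<in> states G" and v: "v \<in> verts G"
  shows "\<exists>e0\<in>Pow (verts G). utility G s v \<le> utility G (s(v := single_edge_strategy G v e0)) v"
proof (cases "nbrs G v = {}")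
  case True
  then show ?thesis by (auto simp: utility_eq)
next
  case False
  define B where "B = budget G v"
  have B: "0 \<le> B" using budget_nonneg[OF v] by (simp add: B_def)
  define r where "r = (\<lambda>u x. reward G {v, u} x (s u {v, u}))"
  define \<Delta> where "\<Delta> = (\<lambda>u. r u B - r u 0)"
  obtain u0 where u0: "u0 \<in> nbrs G v" and max: "\<And>u. u \<in> nbrs G v \<Longrightarrow> \<Delta> u \<le> \<Delta> u0"
    using finite_attains_max[OF finite_nbrs False, of \<Delta>] by blast
  \<comment> \<open>The sign matters because \<open>v\<close> may leave budget unspent: raising the
    total contribution to \<open>B\<close> must not lower the bound.\<close>
  have \<Delta>0: "0 \<le> \<Delta> u0"
    using reward_mono[OF nbrsD(5)[OF u0]] state_nonneg(2)[OF s u0] B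
    by (simp add: \<Delta>_def r_def)
  let ?t = "single_edge_strategy G v {v, u0}"
  have "utility G s v = (\<Sum>u\<in>nbrs G v. r u (s v {v, u}))"
    by (simp add: utility_eq r_def)
  also have "\<dots> \<le> (\<Sum>u\<in>nbrs G v. r u 0 + s v {v, u} / B * \<Delta> u)"
    unfolding r_def \<Delta>_def B_def
    by (intro sum_mono reward_chord nbrsD(5) state_nonneg[OF s] contribution_le_budget[OF s])
  also have "\<dots> \<le> (\<Sum>u\<in>nbrs G v. r u 0 + s v {v, u} / B * \<Delta> u0)"
    using B by (intro sum_mono add_left_mono mult_left_mono max divide_nonneg_nonneg
        state_nonneg[OF s])
  also have "\<dots> = (\<Sum>u\<in>nbrs G v. r u 0) + (\<Sum>u\<in>nbrs G v. s v {v, u}) / B * \<Delta> u0"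
    by (simp add: sum.distrib sum_distrib_right sum_divide_distrib)
  \<comment> \<open>If \<open>B = 0\<close>, the quotient is 0 by the convention for division by
    zero, so it is still at most 1.\<close>
  also have "\<dots> \<le> (\<Sum>u\<in>nbrs G v. r u 0) + 1 * \<Delta> u0"
    using strategy_sum_le[OF state_strategy[OF s v]] B \<Delta>0
    by (intro add_left_mono mult_right_mono) (auto simp: B_def divide_le_eq_1)
  also have "\<dots> = (\<Sum>u\<in>nbrs G v. r u 0 + (if u = u0 then \<Delta> u0 else 0))"
    using u0 by (simp add: sum.distrib)
  also have "\<dots> = utility G (s(v := ?t)) v"
    unfolding utility_eq
  proof (intro sum.cong refl)
    fix u assume u: "u \<in> nbrs G v"
    then have "{v, u} \<in> incident G v" by (simp add: incident_eq)
    then show "r u 0 + (if u = u0 then \<Delta> u0 else 0) =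
        reward G {v, u} ((s(v := ?t)) v {v, u}) ((s(v := ?t)) u {v, u})"
      using nbrsD(3)[OF u]
      by (auto simp: single_edge_strategy_def r_def \<Delta>_def B_def doubleton_eq_iff)
  qed
  finally show ?thesis
    using edge_subset_verts[OF nbrsD(5)[OF u0]] by blast
qed

lemma single_edge_states_subset: "single_edge_states G \<subseteq> states G"
  using single_edge_strategy_in unfolding single_edge_states_def states_def
  by (intro PiE_mono) auto

lemma finite_single_edge_states: "finite (single_edge_states G)"
  unfolding single_edge_states_def by (intro finite_PiE) auto

text \<open>Players switch to a single-edge response one after another. No switch lowers welfare,
  and a later switch leaves the strategies of earlier players untouched.\<close>

lemma single_edge_states_dominate:
  assumes s: "s \<in> states G"
  shows "\<exists>s'\<in>single_edge_states G. welfare G s \<le> welfare G s'"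
proof -
  \<comment> \<open>\<open>W\<close> is the set of players that have already switched.\<close>
  have "\<exists>s'\<in>states G. (\<forall>v\<in>W. s' v \<in> single_edge_strategy G v ` Pow (verts G)) \<and>
      welfare G s \<le> welfare G s'" if "finite W" "W \<subseteq> verts G" for W
    using that
  proof (induction W rule: finite_induct)
    case empty
    then show ?case using s by auto
  next
    case (insert v W)
    then obtain s' where s': "s' \<in> states G" "welfare G s \<le> welfare G s'"
      and W: "\<And>w. w \<in> W \<Longrightarrow> s' w \<in> single_edge_strategy G w ` Pow (verts G)"
      by auto
    have v: "v \<in> verts G" using insert.prems by simp
    obtain e0 where e0: "e0 \<in> Pow (verts G)"
      "utility G s' v \<le> utility G (s'(v := single_edge_strategy G v e0)) v"
      using single_edge_response[OF s'(1) v] by blast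
    let ?s = "s'(v := single_edge_strategy G v e0)"
    have "?s \<in> states G" by (intro state_update s' v single_edge_strategy_in)
    moreover have "welfare G s \<le> welfare G ?s"
      using welfare_update_mono[OF s'(1) v single_edge_strategy_in[OF v] e0(2)] s'(2) by linarith
    moreover have "\<forall>w\<in>insert v W. ?s w \<in> single_edge_strategy G w ` Pow (verts G)"
      using W e0 by auto
    ultimately show ?case by blast
  qed
  from this[OF finite_verts subset_refl] obtain s' where "s' \<in> states G" "welfare G s \<le> welfare G s'"
    "\<forall>v\<in>verts G. s' v \<in> single_edge_strategy G v ` Pow (verts G)" by blast
  moreover from this have "s' \<in> single_edge_states G"
    by (auto simp: single_edge_states_def states_def PiE_iff)
  ultimately show ?thesis by blast
qed

lemma zero_state_in: "(\<lambda>v\<in>verts G. single_edge_strategy G v {}) \<in> single_edge_states G"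
  by (auto simp: single_edge_states_def)

text \<open>The best of the finitely many single-edge states dominates every state. Existence of a
  social optimum thus follows without a compactness argument.\<close>

lemma single_edge_optimum: "\<exists>s\<in>single_edge_states G. social_optimum G s"
proof -
  obtain s where s: "s \<in> single_edge_states G"
    and max: "\<And>s'. s' \<in> single_edge_states G \<Longrightarrow> welfare G s' \<le> welfare G s"
    using finite_attains_max[OF finite_single_edge_states, of "welfare G"] zero_state_in by blast
  have "social_optimum G s"
    unfolding social_optimum_def
    using s max single_edge_states_subset single_edge_states_dominate by (meson order_trans subsetD)
  with s show ?thesis by blast
qed

section \<open>Charging a single-edge state to an equilibrium\<close>

text \<open>Rewards need not vanish at \<open>(0, 0)\<close>. This part of the utility is earned
  without any investment, so no investing player can be charged for it and it is split off
  first.\<close>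

definition base :: "'v \<Rightarrow> real" where
  "base v = (\<Sum>u\<in>nbrs G v. reward G {v, u} 0 0)"

lemma base_nonneg: "0 \<le> base v"
  unfolding base_def by (intro sum_nonneg reward_nonneg nbrsD(5)) auto

lemma utility_ge_base:
  assumes s: "s \<in> states G"
  shows "base v \<le> utility G s v"
  unfolding base_def utility_eq
  by (intro sum_mono reward_mono nbrsD(5) state_nonneg[OF s]) auto

text \<open>By monotonicity every incident edge contributes a nonnegative excess over its base
  reward, so a single excess is at most their sum.\<close>

lemma utility_ge_edge:
  assumes s: "s \<in> states G" and u: "u \<in> nbrs G v"
  shows "reward G {v, u} (s v {v, u}) (s u {v, u}) - reward G {v, u} 0 0 \<le> utility G s v - base v"
proof -
  have "utility G s v - base v =
      (\<Sum>u\<in>nbrs G v. reward G {v, u} (s v {v, u}) (s u {v, u}) - reward G {v, u} 0 0)"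
    by (simp add: utility_eq base_def sum_subtractf)
  moreover have "0 \<le> reward G {v, u} (s v {v, u}) (s u {v, u}) - reward G {v, u} 0 0"
    if "u \<in> nbrs G v" for u
    using reward_mono[OF nbrsD(5)[OF that], of 0 _ 0] state_nonneg[OF s that] by simp
  ultimately show ?thesis
    using member_le_sum[OF u, of "\<lambda>u. reward G {v, u} (s v {v, u}) (s u {v, u}) - reward G {v, u} 0 0"]
    by simp
qed

text \<open>Let \<open>v\<close> alone copy its whole strategy from \<open>so\<close>. Since
  \<open>u\<close> contributes 0 to the edge in \<open>so\<close>, and at least 0 in
  \<open>s\<close>, the edge then pays at least what it pays in \<open>so\<close>; the Nash property
  says that \<open>v\<close> cannot gain by this.\<close>

lemma unilateral_charge:
  assumes s: "nash_equilibrium G s" and o: "so \<in> states G" and u: "u \<in> nbrs G v"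
    and z: "so u {v, u} = 0"
  shows "reward G {v, u} (so v {v, u}) (so u {v, u}) - reward G {v, u} 0 0 \<le> utility G s v - base v"
proof -
  note e = nbrsD[OF u]
  have st: "s \<in> states G" using s by (simp add: nash_equilibrium_def)
  have t: "so v \<in> strategies G v" by (rule state_strategy[OF o e(2)])
  let ?s = "s(v := so v)"
  have s': "?s \<in> states G" by (rule state_update[OF st e(2) t])
  have "reward G {v, u} (so v {v, u}) (so u {v, u}) \<le> reward G {v, u} (?s v {v, u}) (?s u {v, u})"
    using e z state_nonneg[OF o u] state_nonneg[OF st u] by (intro reward_mono) auto
  also have "\<dots> - reward G {v, u} 0 0 \<le> utility G ?s v - base v"
    by (rule utility_ge_edge[OF s' u])
  also have "utility G ?s v \<le> utility G s v"
    using s e(2) t by (auto simp: nash_equilibrium_def)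
  finally show ?thesis by simp
qed

text \<open>If both endpoints copy their strategies from \<open>so\<close>, the edge pays exactly
  what it pays there, and each endpoint has an excess of at least \<open>g\<close>. Were
  \<open>g\<close> above both equilibrium excesses, this would be an improving bilateral
  deviation.\<close>

lemma bilateral_charge:
  assumes s: "pairwise_equilibrium G s" and o: "so \<in> states G" and u: "u \<in> nbrs G v"
  defines "g \<equiv> reward G {v, u} (so v {v, u}) (so u {v, u}) - reward G {v, u} 0 0"
  shows "g \<le> utility G s v - base v \<or> g \<le> utility G s u - base u"
proof -
  note e = nbrsD[OF u]
  have st: "s \<in> states G" using s by (simp add: pairwise_equilibrium_def nash_equilibrium_def)
  let ?s = "s(v := so v, u := so u)"
  have t: "so v \<in> strategies G v" "so u \<in> strategies G u"
    using state_strategy[OF o] e by auto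
  have s': "?s \<in> states G" by (intro state_update st e t)
  have "g \<le> utility G ?s v - base v"
    using utility_ge_edge[OF s' u] e(3) by (simp add: g_def)
  moreover have "g \<le> utility G ?s u - base u"
    using utility_ge_edge[OF s' e(4)] e(3) reward_commute[OF e(5)] state_nonneg[OF o u]
    by (simp add: g_def insert_commute)
  moreover have "\<not> improving_bilateral_deviation G s v u (so v) (so u)"
    using s by (simp add: pairwise_equilibrium_def)
  ultimately show ?thesis
    using e t by (auto simp: improving_bilateral_deviation_def)
qed

text \<open>Distinct neighbours give distinct edges and only one edge can carry a nonzero
  contribution. Hence each player is charged at most once.\<close>

lemma single_edge_card:
  assumes o: "so \<in> single_edge_states G" and v: "v \<in> verts G"
  shows "card {u \<in> nbrs G v. so v {v, u} \<noteq> 0} \<le> 1"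
proof -
  obtain e0 where "so v = single_edge_strategy G v e0"
    using o v by (auto simp: single_edge_states_def)
  then have "{v, u} = e0" if "u \<in> nbrs G v" "so v {v, u} \<noteq> 0" for u
    using that by (auto simp: single_edge_strategy_def incident_eq split: if_splits)
  then have "\<exists>w. {u \<in> nbrs G v. so v {v, u} \<noteq> 0} \<subseteq> {w}"
    by (smt (verit) doubleton_eq_iff mem_Collect_eq singletonI subsetI)
  then show ?thesis
    by (metis card_mono finite.emptyI finite.insertI is_singletonI is_singleton_altdef)
qed

lemma welfare_le_twice_equilibrium:
  assumes s: "pairwise_equilibrium G s" and o: "so \<in> single_edge_states G"
  shows "welfare G so \<le> 2 * welfare G s"
proof -
  have so: "so \<in> states G" using o single_edge_states_subset by blast
  have nash: "nash_equilibrium G s" using s by (simp add: pairwise_equilibrium_def)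
  have st: "s \<in> states G" using nash by (simp add: nash_equilibrium_def)
  define \<phi> where "\<phi> = (\<lambda>v. utility G s v - base v)"
  have \<phi>: "0 \<le> \<phi> v" for v using utility_ge_base[OF st] by (simp add: \<phi>_def)
  \<comment> \<open>\<open>A v u\<close> is the charge that the edge \<open>{v, u}\<close> places on
    its endpoint \<open>v\<close>.\<close>
  define A where "A = (\<lambda>v u. if so v {v, u} \<noteq> 0 then \<phi> v else 0)"
  \<comment> \<open>An edge without contributions has no excess. With one contributor the unilateral
    bound applies; with two, one of the two charges already suffices and the other is
    nonnegative.\<close>
  have charge: "reward G {v, u} (so v {v, u}) (so u {v, u}) - reward G {v, u} 0 0 \<le> A v u + A u v"
    if u: "u \<in> nbrs G v" for v u
  proof -
    note e = nbrsD[OF u]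
    have comm: "reward G {v, u} (so v {v, u}) (so u {v, u}) = reward G {v, u} (so u {v, u}) (so v {v, u})"
      using e state_nonneg[OF so u] by (intro reward_commute) auto
    consider "so v {v, u} = 0" "so u {v, u} = 0" | "so v {v, u} \<noteq> 0" "so u {v, u} = 0"
      | "so v {v, u} = 0" "so u {v, u} \<noteq> 0" | "so v {v, u} \<noteq> 0" "so u {v, u} \<noteq> 0" by blast
    then show ?thesis
    proof cases
      case 2
      then show ?thesis
        using unilateral_charge[OF nash so u] by (simp add: A_def \<phi>_def insert_commute)
    next
      case 3
      then show ?thesis
        using unilateral_charge[OF nash so e(4)] comm by (simp add: A_def \<phi>_def insert_commute)
    next
      case 4
      then show ?thesis
        using bilateral_charge[OF s so u] \<phi>[of u] \<phi>[of v]
        by (auto simp: A_def \<phi>_def insert_commute)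
    qed (simp add: A_def insert_commute)
  qed
  have A_sum: "(\<Sum>u\<in>nbrs G v. A v u) \<le> \<phi> v" if v: "v \<in> verts G" for v
  proof -
    have "(\<Sum>u\<in>nbrs G v. A v u) = of_nat (card {u \<in> nbrs G v. so v {v, u} \<noteq> 0}) * \<phi> v"
      by (simp add: A_def sum.If_cases Int_def)
    also have "\<dots> \<le> 1 * \<phi> v"
      using single_edge_card[OF o v] \<phi>[of v] by (intro mult_right_mono) auto
    finally show ?thesis by simp
  qed
  have "welfare G so - (\<Sum>v\<in>verts G. base v) = (\<Sum>v\<in>verts G. \<Sum>u\<in>nbrs G v.
      reward G {v, u} (so v {v, u}) (so u {v, u}) - reward G {v, u} 0 0)"
    by (simp add: welfare_def utility_eq base_def sum_subtractf)
  also have "\<dots> \<le> (\<Sum>v\<in>verts G. \<Sum>u\<in>nbrs G v. A v u + A u v)"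
    by (intro sum_mono charge)
  also have "\<dots> = 2 * (\<Sum>v\<in>verts G. \<Sum>u\<in>nbrs G v. A v u)"
    using sum_nbrs_swap[of A] by (simp add: sum.distrib)
  also have "\<dots> \<le> 2 * (\<Sum>v\<in>verts G. \<phi> v)"
    by (intro mult_left_mono sum_mono A_sum) auto
  also have "\<dots> = 2 * welfare G s - 2 * (\<Sum>v\<in>verts G. base v)"
    by (simp add: \<phi>_def welfare_def sum_subtractf)
  \<comment> \<open>The base is subtracted once on the left and twice on the right, so the surplus
    copy may be dropped because it is nonnegative.\<close>
  finally show ?thesis
    using sum_nonneg[of "verts G" base] base_nonneg by simp
qed

section \<open>Bounds on the prices of a single game\<close>

text \<open>All optima have equal welfare, so the bound for a single-edge optimum carries over to an
  arbitrary one.\<close>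

lemma welfare_ratio_le_2:
  assumes s: "pairwise_equilibrium G s" and o: "social_optimum G so"
  shows "welfare_ratio (welfare G so) (welfare G s) \<le> 2"
proof -
  obtain s1 where "s1 \<in> single_edge_states G" "social_optimum G s1"
    using single_edge_optimum by blast
  then have le: "welfare G so \<le> 2 * welfare G s"
    using welfare_le_twice_equilibrium[OF s, of s1] o by (force simp: social_optimum_def)
  have "0 \<le> welfare G so" using o welfare_nonneg by (simp add: social_optimum_def)
  show ?thesis
  \<comment> \<open>Zero equilibrium welfare forces zero optimal welfare, and the ratio is then 1 by
    definition.\<close>
  proof (cases "welfare G s = 0")
    case True
    then show ?thesis using le \<open>0 \<le> welfare G so\<close> by (simp add: welfare_ratio_def)
  next
    case False
    then have pos: "0 < welfare G s" using le \<open>0 \<le> welfare G so\<close> by simp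
    then have "ennreal (welfare G so) / ennreal (welfare G s) = ennreal (welfare G so / welfare G s)"
      using \<open>0 \<le> welfare G so\<close> by (simp add: divide_ennreal)
    also have "\<dots> \<le> ennreal 2"
      using le pos by (intro ennreal_leI) (simp add: divide_le_eq)
    finally show ?thesis using pos by (simp add: welfare_ratio_def)
  qed
qed

lemma price_of_anarchy_le_2: "price_of_anarchy G \<le> 2"
  unfolding price_of_anarchy_def using welfare_ratio_le_2 by (intro Sup_least) auto

text \<open>An infimum is at most the supremum of the same set once the set is nonempty, which takes
  an optimum besides the given equilibrium.\<close>

lemma price_of_stability_le_price_of_anarchy:
  assumes "pairwise_equilibrium G s"
  shows "price_of_stability G \<le> price_of_anarchy G"
proof -
  obtain so where "social_optimum G so" using single_edge_optimum by blast
  then have "welfare_ratio (welfare G so) (welfare G s) \<in>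
      {welfare_ratio (welfare G s') (welfare G s) | s' s. social_optimum G s' \<and> pairwise_equilibrium G s}"
    using assms by blast
  then show ?thesis
    unfolding price_of_anarchy_def price_of_stability_def
    by (meson Inf_lower Sup_upper order_trans)
qed

end

section \<open>Lower bound: bilinear rewards on a path\<close>

lemma bilinear_reward:
  assumes "0 \<le> (w::real)"
  shows "reward_function (\<lambda>x y. w * x * y)" "(\<lambda>x y. w * x * y) \<in> class_C"
proof -
  have basic: "nonneg_valued (\<lambda>x y. w * x * y)" "symmetric_fun (\<lambda>x y. w * x * y)"
    "nondecreasing_fun (\<lambda>x y. w * x * y)"
    using assms by (auto simp: nonneg_valued_def symmetric_fun_def nondecreasing_fun_def
        intro!: mono_onI mult_mono)
  have linear: "second_derivative_nonneg (\<lambda>x. c * x)" for c :: real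
    unfolding second_derivative_nonneg_def
    by (rule exI[of _ "\<lambda>_. c"], rule exI[of _ "\<lambda>_. 0"]) (auto intro!: derivative_eq_intros)
  have "coordinate_convex (\<lambda>x y. w * x * y)"
  proof -
    have "second_derivative_nonneg (\<lambda>x. w * x * y)" for y
      using linear[of "w * y"] by (simp add: mult_ac)
    then show ?thesis using linear by (simp add: coordinate_convex_def)
  qed
  with basic show "(\<lambda>x y. w * x * y) \<in> class_C" by (simp add: class_C_def)
  have "(\<lambda>(x, y). w * x * y) differentiable_on ({0..} \<times> {0..})"
    unfolding case_prod_unfold differentiable_on_def
    by (intro ballI differentiable_mult differentiable_const)
      (auto intro: bounded_linear_imp_differentiable bounded_linear_fst bounded_linear_snd)
  then show "reward_function (\<lambda>x y. w * x * y)"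
    using basic differentiable_imp_continuous_on by (auto simp: reward_function_def)
qed

text \<open>This bounds the utility of a middle player of the path: \<open>x\<close> and
  \<open>p\<close> are its contributions to the outer and the middle edge, \<open>a\<close> and
  \<open>q\<close> those of its partners. As \<open>a\<close> and \<open>q\<close> are at most 1,
  the value is at most \<open>x + (1 + \<epsilon>) * p \<le> 1 + \<epsilon> * p\<close>.\<close>

lemma split_budget_le:
  fixes x p q \<epsilon> :: real
  assumes "0 \<le> x" "0 \<le> p" "x + p \<le> 1" "q \<le> 1" "0 \<le> a" "a \<le> 1" "0 < \<epsilon>"
  shows "x * a + (1 + \<epsilon>) * p * q \<le> 1 + \<epsilon>"
    and "p \<noteq> 1 \<or> q \<noteq> 1 \<Longrightarrow> x * a + (1 + \<epsilon>) * p * q < 1 + \<epsilon>"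
proof -
  have "x * a \<le> x" using assms by (simp add: mult_left_le)
  moreover have "(1 + \<epsilon>) * p * q \<le> (1 + \<epsilon>) * p"
    using assms by (intro mult_left_le) auto
  ultimately have le: "x * a + (1 + \<epsilon>) * p * q \<le> 1 + \<epsilon> * p"
    using assms by (simp add: algebra_simps)
  moreover have p: "\<epsilon> * p \<le> \<epsilon> * 1" using assms by (intro mult_left_mono) auto
  ultimately show "x * a + (1 + \<epsilon>) * p * q \<le> 1 + \<epsilon>" by linarith
  assume "p \<noteq> 1 \<or> q \<noteq> 1"
  then consider "p < 1" | "p = 1" "q < 1" using assms by linarith
  then show "x * a + (1 + \<epsilon>) * p * q < 1 + \<epsilon>"
  proof cases
    case 1
    then have "\<epsilon> * p < \<epsilon> * 1" using assms by (intro mult_strict_left_mono) auto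
    with le show ?thesis by linarith
  next
    \<comment> \<open>The bound in terms of \<open>p\<close> is tight here; strictness comes from
      \<open>q < 1\<close>, the outer edge having received nothing.\<close>
    case 2
    then have "x = 0" using assms by simp
    with 2 assms show ?thesis by simp
  qed
qed

text \<open>A positive \<open>\<epsilon>\<close> makes the middle edge strictly better for
  \<open>b\<close> and \<open>c\<close>. At \<open>\<epsilon> = 0\<close>, full investment in the
  outer edges would itself be a pairwise equilibrium, so the value 2 is only approached.\<close>

definition path_game :: "'v \<Rightarrow> 'v \<Rightarrow> 'v \<Rightarrow> 'v \<Rightarrow> real \<Rightarrow> 'v game" where
  "path_game a b c d \<epsilon> =
     \<lparr>verts = {a, b, c, d}, edges = {{a, b}, {b, c}, {c, d}}, budget = (\<lambda>_. 1),
      reward = (\<lambda>e x y. (if e = {b, c} then 1 + \<epsilon> else 1) * x * y)\<rparr>"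

locale path =
  fixes a b c d :: 'v and \<epsilon> :: real
  assumes dist: "distinct [a, b, c, d]" and eps: "0 < \<epsilon>"
begin

abbreviation "P \<equiv> path_game a b c d \<epsilon>"

lemma neq: "a \<noteq> b" "b \<noteq> a" "a \<noteq> c" "c \<noteq> a" "a \<noteq> d" "d \<noteq> a" "b \<noteq> c" "c \<noteq> b" "b \<noteq> d" "d \<noteq> b"
  "c \<noteq> d" "d \<noteq> c"
  using dist by auto

lemma path_convex: "P \<in> convex_games"
proof -
  have "reward P e = (\<lambda>x y. (if e = {b, c} then 1 + \<epsilon> else 1) * x * y)" for e
    by (simp add: path_game_def)
  moreover have "0 \<le> (if e = {b, c} then 1 + \<epsilon> else 1)" for e
    using eps by simp
  ultimately have "reward_function (reward P e)" "reward P e \<in> class_C" for e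
    using bilinear_reward by metis+
  moreover have "edges P \<subseteq> {{u, v} | u v. u \<in> verts P \<and> v \<in> verts P \<and> u \<noteq> v}"
    using neq by (auto simp: path_game_def)
  ultimately show ?thesis
    by (simp add: convex_games_def contribution_game_def) (simp add: path_game_def)
qed

sublocale convex_game P
  by unfold_locales (rule path_convex)

lemma verts_path: "verts P = {a, b, c, d}"
  by (simp add: path_game_def)

lemma incident_path:
  "incident P a = {{a, b}}" "incident P b = {{a, b}, {b, c}}"
  "incident P c = {{b, c}, {c, d}}" "incident P d = {{c, d}}"
  using neq by (auto simp: incident_def path_game_def)

lemma nbrs_path: "nbrs P a = {b}" "nbrs P b = {a, c}" "nbrs P c = {b, d}" "nbrs P d = {c}"
  using neq by (auto simp: nbrs_def path_game_def doubleton_eq_iff)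

lemma utility_path:
  "utility P s a = s a {a, b} * s b {a, b}"
  "utility P s b = s b {a, b} * s a {a, b} + (1 + \<epsilon>) * s b {b, c} * s c {b, c}"
  "utility P s c = s c {c, d} * s d {c, d} + (1 + \<epsilon>) * s c {b, c} * s b {b, c}"
  "utility P s d = s d {c, d} * s c {c, d}"
  using neq by (simp_all add: utility_eq nbrs_path) (auto simp: path_game_def doubleton_eq_iff insert_commute)

lemma strategies_path:
  "t \<in> strategies P a \<longleftrightarrow> t \<in> extensional {{a, b}} \<and> 0 \<le> t {a, b} \<and> t {a, b} \<le> 1"
  "t \<in> strategies P b \<longleftrightarrow> t \<in> extensional {{a, b}, {b, c}} \<and>
     0 \<le> t {a, b} \<and> 0 \<le> t {b, c} \<and> t {a, b} + t {b, c} \<le> 1"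
  "t \<in> strategies P c \<longleftrightarrow> t \<in> extensional {{b, c}, {c, d}} \<and>
     0 \<le> t {c, d} \<and> 0 \<le> t {b, c} \<and> t {c, d} + t {b, c} \<le> 1"
  "t \<in> strategies P d \<longleftrightarrow> t \<in> extensional {{c, d}} \<and> 0 \<le> t {c, d} \<and> t {c, d} \<le> 1"
proof -
  have "{a, b} \<noteq> {b, c}" "{b, c} \<noteq> {c, d}" using neq by (auto simp: doubleton_eq_iff)
  moreover have "budget P v = 1" for v by (simp add: path_game_def)
  ultimately show
    "t \<in> strategies P a \<longleftrightarrow> t \<in> extensional {{a, b}} \<and> 0 \<le> t {a, b} \<and> t {a, b} \<le> 1"
    "t \<in> strategies P b \<longleftrightarrow> t \<in> extensional {{a, b}, {b, c}} \<and>
     0 \<le> t {a, b} \<and> 0 \<le> t {b, c} \<and> t {a, b} + t {b, c} \<le> 1"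
    "t \<in> strategies P c \<longleftrightarrow> t \<in> extensional {{b, c}, {c, d}} \<and>
     0 \<le> t {c, d} \<and> 0 \<le> t {b, c} \<and> t {c, d} + t {b, c} \<le> 1"
    "t \<in> strategies P d \<longleftrightarrow> t \<in> extensional {{c, d}} \<and> 0 \<le> t {c, d} \<and> t {c, d} \<le> 1"
    by (auto simp: strategies_def incident_path PiE_iff add.commute)
qed

lemma state_path:
  assumes "s \<in> states P"
  shows "0 \<le> s a {a, b}" "s a {a, b} \<le> 1" "0 \<le> s b {a, b}" "0 \<le> s b {b, c}"
    "s b {a, b} + s b {b, c} \<le> 1" "0 \<le> s c {c, d}" "0 \<le> s c {b, c}" "s c {c, d} + s c {b, c} \<le> 1"
    "0 \<le> s d {c, d}" "s d {c, d} \<le> 1"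
  using state_strategy[OF assms, of a] state_strategy[OF assms, of b]
    state_strategy[OF assms, of c] state_strategy[OF assms, of d]
  by (simp_all add: verts_path strategies_path)

lemma middle_utility_le:
  assumes s: "s \<in> states P"
  shows "utility P s b \<le> 1 + \<epsilon>" "utility P s c \<le> 1 + \<epsilon>"
  using state_path[OF s] eps by (auto simp: utility_path intro!: split_budget_le)

lemma middle_utility_less:
  assumes s: "s \<in> states P" and "s b {b, c} \<noteq> 1 \<or> s c {b, c} \<noteq> 1"
  shows "utility P s b < 1 + \<epsilon>" "utility P s c < 1 + \<epsilon>"
  using state_path[OF s] eps assms(2) by (auto simp: utility_path intro!: split_budget_le)

text \<open>\<open>{b, c}\<close> is not an edge at \<open>a\<close> or \<open>d\<close>, so these
  two contribute nothing.\<close>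

definition middle_state :: "'v \<Rightarrow> 'v set \<Rightarrow> real" where
  "middle_state = (\<lambda>v\<in>verts P. single_edge_strategy P v {b, c})"

definition outer_state :: "'v \<Rightarrow> 'v set \<Rightarrow> real" where
  "outer_state = (\<lambda>v\<in>verts P. single_edge_strategy P v (if v \<in> {a, b} then {a, b} else {c, d}))"

lemma path_states: "middle_state \<in> states P" "outer_state \<in> states P"
  using single_edge_strategy_in by (auto simp: middle_state_def outer_state_def states_def)

lemma single_edge_strategy_path:
  "e \<in> incident P v \<Longrightarrow> single_edge_strategy P v e0 e = (if e = e0 then 1 else 0)"
  by (simp add: single_edge_strategy_def) (simp add: path_game_def)

lemma welfare_path: "welfare P s = utility P s a + utility P s b + utility P s c + utility P s d"
  using neq by (simp add: welfare_def verts_path)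

lemma welfare_outer: "welfare P outer_state = 4"
  using neq
  by (simp add: welfare_path utility_path outer_state_def verts_path single_edge_strategy_path
      incident_path doubleton_eq_iff)

lemma utility_middle:
  "utility P middle_state b = 1 + \<epsilon>" "utility P middle_state c = 1 + \<epsilon>"
  using neq
  by (simp_all add: utility_path middle_state_def verts_path single_edge_strategy_path
      incident_path doubleton_eq_iff)

lemma middle_idle: "middle_state b {a, b} = 0" "middle_state c {c, d} = 0"
  using neq
  by (simp_all add: middle_state_def verts_path single_edge_strategy_path incident_path
      doubleton_eq_iff)

text \<open>\<open>b\<close> and \<open>c\<close> already receive the largest utility possible in
  any state, so neither joins a deviation. \<open>a\<close> and \<open>d\<close> earn 0 whatever
  they do, alone or together, since their only neighbours are idle on the outer edges.\<close>

lemma middle_pairwise: "pairwise_equilibrium P middle_state"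
  unfolding pairwise_equilibrium_def
proof (intro conjI notI)
  show "nash_equilibrium P middle_state"
    unfolding nash_equilibrium_def
  proof (intro conjI ballI path_states)
    fix v t assume v: "v \<in> verts P" and t: "t \<in> strategies P v"
    have s: "middle_state(v := t) \<in> states P" by (rule state_update[OF path_states(1) v t])
    from v consider "v = a" | "v = b" | "v = c" | "v = d" by (auto simp: verts_path)
    then show "utility P (middle_state(v := t)) v \<le> utility P middle_state v"
      using middle_utility_le[OF s] neq by cases (simp_all add: utility_middle utility_path(1,4) middle_idle)
  qed
next
  assume "\<exists>u v t t'. improving_bilateral_deviation P middle_state u v t t'"
  then obtain u v t t' where dev: "improving_bilateral_deviation P middle_state u v t t'" by blast
  let ?s = "middle_state(u := t, v := t')"
  have uv: "u \<in> verts P" "v \<in> verts P" "u \<noteq> v" "t \<in> strategies P u" "t' \<in> strategies P v"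
    and gain: "utility P middle_state u < utility P ?s u" "utility P middle_state v < utility P ?s v"
    using dev by (auto simp: improving_bilateral_deviation_def)
  have s: "?s \<in> states P" by (intro state_update path_states uv)
  have "w \<notin> {b, c}" if "w \<in> {u, v}" for w
    using gain that middle_utility_le[OF s] utility_middle by fastforce
  then have "u \<in> {a, d}" "v \<in> {a, d}" using uv by (auto simp: verts_path)
  then show False
    using gain uv neq by (auto simp: utility_path middle_idle)
qed

text \<open>Unless both \<open>b\<close> and \<open>c\<close> invest everything in the middle edge,
  both are strictly below \<open>1 + \<epsilon>\<close> and would gain by moving there together.
  Full investment leaves each outer reward with a zero factor.\<close>

lemma pairwise_welfare:
  assumes s: "pairwise_equilibrium P s"
  shows "welfare P s = 2 * (1 + \<epsilon>)"
proof -
  have st: "s \<in> states P" using s by (simp add: pairwise_equilibrium_def nash_equilibrium_def)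
  let ?t = "\<lambda>v. single_edge_strategy P v {b, c}"
  let ?s = "s(b := ?t b, c := ?t c)"
  have "utility P ?s b \<ge> 1 + \<epsilon>" "utility P ?s c \<ge> 1 + \<epsilon>"
    using neq state_path[OF st]
    by (simp_all add: utility_path single_edge_strategy_path incident_path doubleton_eq_iff)
  moreover have "\<not> improving_bilateral_deviation P s b c (?t b) (?t c)"
    using s by (simp add: pairwise_equilibrium_def)
  ultimately have one: "s b {b, c} = 1" "s c {b, c} = 1"
    using middle_utility_less[OF st] neq single_edge_strategy_in
    by (force simp: improving_bilateral_deviation_def verts_path)+
  then have "s b {a, b} = 0" "s c {c, d} = 0" using state_path[OF st] by auto
  with one show ?thesis by (simp add: welfare_path utility_path)
qed

text \<open>All equilibria have the same welfare, so even the best one is covered. The outer state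
  witnesses that the optimum is at least 4.\<close>

lemma price_of_stability_path: "ennreal (2 / (1 + \<epsilon>)) \<le> price_of_stability P"
  unfolding price_of_stability_def
proof (rule Inf_greatest)
  fix r assume "r \<in> {welfare_ratio (welfare P s') (welfare P s) | s' s.
    social_optimum P s' \<and> pairwise_equilibrium P s}"
  then obtain s' s where r: "r = welfare_ratio (welfare P s') (welfare P s)"
    and o: "social_optimum P s'" and s: "pairwise_equilibrium P s" by blast
  have opt: "4 \<le> welfare P s'"
    using o path_states(2) welfare_outer by (force simp: social_optimum_def)
  have "2 / (1 + \<epsilon>) = 4 / (2 * (1 + \<epsilon>))"
    using eps by (simp add: field_simps)
  also have "\<dots> \<le> welfare P s' / (2 * (1 + \<epsilon>))"
    using eps opt by (intro divide_right_mono) auto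
  finally have "ennreal (2 / (1 + \<epsilon>)) \<le> ennreal (welfare P s' / (2 * (1 + \<epsilon>)))"
    by (rule ennreal_leI)
  also have "\<dots> = r"
    using opt eps divide_ennreal[of "welfare P s'" "2 * (1 + \<epsilon>)"]
    unfolding r welfare_ratio_def pairwise_welfare[OF s] by auto
  finally show "ennreal (2 / (1 + \<epsilon>)) \<le> r" .
qed

end

section \<open>The limit of path games and the exact values\<close>

lemma class_price_of_stability_ge_2:
  assumes "infinite (UNIV :: 'v set)"
  shows "2 \<le> class_price_of_stability (convex_games :: 'v game set)"
proof -
  \<comment> \<open>The infinite player type supplies four distinct players for the path.\<close>
  obtain S :: "'v set" where "finite S" "card S = 4"
    using infinite_arbitrarily_large[OF assms] by blast
  then obtain xs where xs: "set xs = S" "distinct xs" "length xs = 4"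
    using finite_distinct_list distinct_card by metis
  then obtain a b c d :: 'v where dist: "distinct [a, b, c, d]"
    by (auto simp: numeral_eq_Suc length_Suc_conv)
  have bound: "ennreal (2 / (1 + \<epsilon>)) \<le> class_price_of_stability (convex_games :: 'v game set)"
    if "\<epsilon> > 0" for \<epsilon>
  proof -
    interpret path a b c d \<epsilon> using dist that by unfold_locales
    have "price_of_stability P \<le> class_price_of_stability (convex_games :: 'v game set)"
      unfolding class_price_of_stability_def
      using path_convex middle_pairwise by (intro SUP_upper CollectI conjI exI)
    with price_of_stability_path show ?thesis by (rule order_trans)
  qed
  \<comment> \<open>The class price bounds \<open>2 / (1 + \<epsilon>)\<close> for every positive
    \<open>\<epsilon>\<close>, hence also the limit from the right at 0.\<close>
  have "((\<lambda>\<epsilon>::real. 2 / (1 + \<epsilon>)) \<longlongrightarrow> 2 / (1 + 0)) (at_right 0)"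
    by (intro tendsto_intros) auto
  then have "((\<lambda>\<epsilon>. ennreal (2 / (1 + \<epsilon>))) \<longlongrightarrow> ennreal 2) (at_right 0)"
    by (intro tendsto_ennrealI) simp
  moreover have "\<forall>\<^sub>F \<epsilon> in at_right 0.
      ennreal (2 / (1 + \<epsilon>)) \<le> class_price_of_stability (convex_games :: 'v game set)"
    using bound by (auto simp: eventually_at_right_less intro: eventually_mono[OF eventually_at_right_less])
  ultimately have "ennreal 2 \<le> class_price_of_stability (convex_games :: 'v game set)"
    by (rule tendsto_upperbound) simp
  then show ?thesis by simp
qed

theorem theorem2p9:
  assumes "infinite (UNIV :: 'v set)"
  shows "class_price_of_anarchy (convex_games :: 'v game set) = 2 \<and>
         class_price_of_stability (convex_games :: 'v game set) = 2"
proof -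
  have anarchy: "class_price_of_anarchy (convex_games :: 'v game set) \<le> 2"
    unfolding class_price_of_anarchy_def
    by (rule SUP_least) (auto intro: convex_game.price_of_anarchy_le_2 convex_game.intro)
  have stability: "class_price_of_stability (convex_games :: 'v game set) \<le>
      class_price_of_anarchy (convex_games :: 'v game set)"
    unfolding class_price_of_anarchy_def class_price_of_stability_def
    by (rule SUP_mono) (blast intro: convex_game.price_of_stability_le_price_of_anarchy convex_game.intro)
  \<comment> \<open>Both prices are squeezed: 2 is at most the price of stability, which is at most
    the price of anarchy, which is at most 2.\<close>
  show ?thesis
    using anarchy stability class_price_of_stability_ge_2[OF assms] by (meson antisym order_trans)
qed

end
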